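(* With $\beta=q+q^{-1}$ and $\varrho=\varphi q^{N-2}(q+1)^2$, we have \[ A^3A^*-(\beta+1)A^2A^*A+(\beta+1)AA^*A^2-A^*A^3=\varrho\,(AA^*-A^*A). \]
   Context: Let $q$ be a prime power, $GF(q)$ the field with $q$ elements, $N\ge 1$ an integer, and $\mathbf V$ an $N$-dimensional vector space over $GF(q)$. Let $X$ be the set of all subspaces of $\mathbf V$, ordered by inclusion (the projective geometry $L_N(q)$). For $y,z\in X$, $y$ covers $z$ means $z\subseteq y$ and $\dim y-\dim z=1$. ${\rm Mat}_X(\mathbb C)$ is the algebra of complex matrices with rows and columns indexed by $X$. $A^*\in{\rm Mat}_X(\mathbb C)$ is the diagonal matrix with $(y,y)$-entry $q^{-\dim y}$. Fix a real number $\varphi>0$. The matrix $A\in{\rm Mat}_X(\mathbb C)$ has $(y,z)$-entry $1$ if $y$ covers $z$; $\varphi q^{\dim y}$ if $z$ covers $y$; $\frac{\varphi-1}{q-1}q^{\dim y}$ if $y=z$; and $0$ otherwise. *)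

theory Defs
  imports "HOL-Analysis.Analysis"
begin

text \<open>
  The whole type \<open>'v\<close>, with scalar multiplication \<open>scal\<close> by the finite field \<open>'k\<close>, plays the role
  of the vector space. Its set of subspaces depends on \<open>scal\<close>, so it is not a type. To use the
  library's matrices, the subspaces are labelled by a finite type \<open>'x\<close> through a bijection
  \<open>S\<close> from \<open>'x\<close> onto \<open>subspaces scal\<close>; the rows and columns \<open>i\<close>, \<open>j\<close> of a matrix
  in \<open>complex ^ 'x ^ 'x\<close> stand for the subspaces \<open>S i\<close>, \<open>S j\<close>.
\<close>

definition subspaces :: "('k::field \<Rightarrow> 'v::ab_group_add \<Rightarrow> 'v) \<Rightarrow> 'v set set"
  where "subspaces scal = {W. module.subspace scal W}"

definition covers :: "('k::field \<Rightarrow> 'v::ab_group_add \<Rightarrow> 'v) \<Rightarrow> 'v set \<Rightarrow> 'v set \<Rightarrow> bool"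
  where "covers scal y z \<longleftrightarrow>
    z \<subseteq> y \<and> int (vector_space.dim scal y) - int (vector_space.dim scal z) = 1"

definition A_star ::
  "('k::{field,finite} \<Rightarrow> 'v::ab_group_add \<Rightarrow> 'v) \<Rightarrow> ('x::finite \<Rightarrow> 'v set) \<Rightarrow> complex ^ 'x ^ 'x"
  where "A_star scal S =
    (\<chi> i j. if i = j then 1 / of_nat CARD('k) ^ vector_space.dim scal (S i) else 0)"

definition A_mat ::
  "('k::{field,finite} \<Rightarrow> 'v::ab_group_add \<Rightarrow> 'v) \<Rightarrow> real \<Rightarrow> ('x::finite \<Rightarrow> 'v set) \<Rightarrow> complex ^ 'x ^ 'x"
  where "A_mat scal \<phi> S =
    (\<chi> i j.
      if covers scal (S i) (S j) then 1
      else if covers scal (S j) (S i)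
        then complex_of_real (\<phi> * real CARD('k) ^ vector_space.dim scal (S i))
      else if i = j
        then complex_of_real
          ((\<phi> - 1) / (real CARD('k) - 1) * real CARD('k) ^ vector_space.dim scal (S i))
      else 0)"

end

theory Submission
  imports Defs
begin

text \<open>
  Split \<open>A = P + Q + R\<close> into its raising, diagonal and lowering parts. Each part \<open>q\<close>-commutes with
  \<open>A'\<close> and with \<open>Q\<close>, so every trilinear term of the left-hand side is a scalar multiple of
  \<open>A'\<close> times a word in \<open>P\<close>, \<open>Q\<close>, \<open>R\<close>, and all words cancel except those of degree \<open>1\<close> and
  \<open>-1\<close> involving both \<open>P\<close> and \<open>R\<close>. These are evaluated by \<open>R P - q P R = G\<close>, where \<open>G\<close> is diagonal
  with entry \<open>\<phi> (q^N - q^(2 d)) / (q - 1)\<close> at a subspace of dimension \<open>d\<close>. Off the diagonal this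
  relation says that two distinct subspaces have as many common covers as commonly covered subspaces
  (at most one each); on the diagonal it comes from counting the \<open>(q^(N - d) - 1) / (q - 1)\<close> covers and
  the \<open>(q^d - 1) / (q - 1)\<close> hyperplanes of a \<open>d\<close>-dimensional subspace.
\<close>

subsection \<open>Counting subspaces\<close>

lemma card_field_gt_1: "1 < CARD('k::{field,finite})"
proof -
  have "card {0, 1 :: 'k} \<le> CARD('k)" by (intro card_mono) auto
  then show ?thesis by simp
qed

locale finite_vector_space = finite_dimensional_vector_space scale Basis
  for scale :: "'k::{field,finite} \<Rightarrow> 'v::ab_group_add \<Rightarrow> 'v" and Basis
begin

lemma covers_iff: "covers scale y z \<longleftrightarrow> z \<subseteq> y \<and> dim y = Suc (dim z)"
  unfolding covers_def by auto

lemma span_of_subspace: "subspace Z \<Longrightarrow> span Z = Z"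
  by simp

text \<open>Each vector of the span is \<open>z + scale c v\<close> for exactly one pair: two
  different coefficients would put a nonzero multiple of \<open>v\<close>, hence \<open>v\<close>
  itself, into \<open>Z\<close>.\<close>

lemma card_span_insert:
  assumes "subspace Z" "v \<notin> Z"
  shows "card (span (insert v Z)) = CARD('k) * card Z"
proof -
  have "bij_betw (\<lambda>(c, z). z + scale c v) (UNIV \<times> Z) (span (insert v Z))"
    unfolding bij_betw_def
  proof
    show "inj_on (\<lambda>(c, z). z + scale c v) (UNIV \<times> Z)"
    proof (clarsimp simp: inj_on_def)
      fix c z c' z'
      assume z: "z \<in> Z" "z' \<in> Z" and eq: "z + scale c v = z' + scale c' v"
      have "scale (c - c') v = z' - z"
        using eq by (simp add: scale_left_diff_distrib algebra_simps)
      then have mem: "scale (c - c') v \<in> Z"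
        using assms(1) z subspace_diff by simp
      have "c = c'"
      proof (rule ccontr)
        assume "c \<noteq> c'"
        then have "v = scale (inverse (c - c')) (scale (c - c') v)"
          by simp
        then show False
          using assms mem subspace_scale by metis
      qed
      then show "c = c' \<and> z = z'" using eq by simp
    qed
    have "x \<in> span (insert v Z) \<longleftrightarrow> (\<exists>c. x - scale c v \<in> Z)" for x
      unfolding span_breakdown_eq span_of_subspace[OF assms(1)] ..
    moreover have "x \<in> (\<lambda>(c, z). z + scale c v) ` (UNIV \<times> Z) \<longleftrightarrow> (\<exists>c. x - scale c v \<in> Z)" for x
    proof
      assume "\<exists>c. x - scale c v \<in> Z"
      then obtain c where "x - scale c v \<in> Z" ..
      then have "(c, x - scale c v) \<in> UNIV \<times> Z" by simp
      then show "x \<in> (\<lambda>(c, z). z + scale c v) ` (UNIV \<times> Z)"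
        by (rule image_eqI[rotated]) simp
    qed (clarsimp, metis add_diff_cancel_right')
    ultimately show "(\<lambda>(c, z). z + scale c v) ` (UNIV \<times> Z) = span (insert v Z)"
      by blast
  qed
  then have "card (UNIV \<times> Z :: ('k \<times> 'v) set) = card (span (insert v Z))"
    by (rule bij_betw_same_card)
  then show ?thesis
    by (simp add: card_cartesian_product)
qed

text \<open>Adjoining the vectors of a basis one at a time multiplies the size by
  \<open>CARD('k)\<close> each time.\<close>

lemma card_subspace:
  assumes "subspace W"
  shows "card W = CARD('k) ^ dim W"
proof -
  obtain B where B: "B \<subseteq> W" "independent B" "W \<subseteq> span B" "card B = dim W"
    using basis_exists .
  have W: "span B = W"
    using B assms span_subspace by blast
  have "finite B" using B finiteI_independent by blast
  then have "independent B \<Longrightarrow> card (span B) = CARD('k) ^ card B"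
  proof (induction B)
    case (insert b B)
    then have "independent B" "b \<notin> span B"
      using independent_insert by auto
    then have "card (span (insert b (span B))) = CARD('k) * CARD('k) ^ card B"
      using insert card_span_insert by simp
    moreover have "span (insert b (span B)) = span (insert b B)"
    proof
      show "span (insert b (span B)) \<subseteq> span (insert b B)"
        using span_mono[of B "insert b B"] by (intro span_minimal) (auto intro: span_base)
      show "span (insert b B) \<subseteq> span (insert b (span B))"
        using span_superset[of B] by (intro span_mono) auto
    qed
    ultimately show ?case using insert by simp
  qed simp
  then show ?thesis using B W by simp
qed

text \<open>An infinite set has \<open>card\<close> 0, but the whole space has a positive power of
  \<open>CARD('k)\<close>.\<close>

lemma finite_UNIV_vectors: "finite (UNIV :: 'v set)"
proof -
  have "CARD('v) > 0" using card_subspace[OF subspace_UNIV] by simp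
  then show ?thesis using card_gt_0_iff by blast
qed

lemma finite_vectors [simp]: "finite (W :: 'v set)"
  by (rule finite_subset[OF subset_UNIV finite_UNIV_vectors])

lemma finite_subspace_sets [simp]: "finite (\<S> :: 'v set set)"
  by (rule finite_subset[OF _ finite_Pow_iff[THEN iffD2, OF finite_UNIV_vectors]]) simp

section \<open>Covers in the subspace lattice: modularity and counting\<close>

lemma covers_spanI:
  assumes "subspace Z" "v \<notin> Z"
  shows "covers scale (span (insert v Z)) Z"
  using assms by (auto simp: covers_iff dim_insert span_of_subspace span_base)

text \<open>The span lies in \<open>Y\<close> and has the same dimension. Hence distinct covers of
  \<open>Z\<close> share no vector outside \<open>Z\<close>, which makes the sets counted below
  disjoint.\<close>

lemma covers_eq_span:
  assumes "subspace Y" "subspace Z" "covers scale Y Z" "v \<in> Y" "v \<notin> Z"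
  shows "Y = span (insert v Z)"
proof -
  have "span (insert v Z) \<subseteq> Y"
    using assms by (intro span_minimal) (auto simp: covers_iff)
  moreover have "dim (span (insert v Z)) = dim Y"
    using assms covers_spanI[of Z v] by (auto simp: covers_iff)
  ultimately show ?thesis
    using assms(1) subspace_dim_equal[of "span (insert v Z)" Y] by simp
qed

lemma subspace_eqI:
  assumes "subspace Y" "subspace Z" "Z \<subseteq> Y" "dim Y = dim Z"
  shows "Y = Z"
  using assms subspace_dim_equal[of Z Y] by simp

text \<open>Modularity: \<open>K\<close> is spanned by \<open>J\<close> and one vector
  \<open>w\<close> of \<open>I\<close> outside \<open>J\<close>. Subtracting the \<open>w\<close>
  part from a vector of \<open>I\<close> leaves a vector of \<open>I \<inter> J\<close>, so
  \<open>w\<close> generates \<open>I\<close> over \<open>I \<inter> J\<close>.\<close>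

lemma covers_Int:
  assumes sub: "subspace I" "subspace J" "subspace K"
    and cov: "covers scale K I" "covers scale K J" and "I \<noteq> J"
  shows "covers scale I (I \<inter> J)"
proof -
  have "\<not> I \<subseteq> J"
    using assms subspace_eqI[of J I] by (auto simp: covers_iff)
  then obtain w where w: "w \<in> I" "w \<notin> J" by blast
  then have K: "K = span (insert w J)"
    using sub cov covers_eq_span by (auto simp: covers_iff)
  have IJ: "subspace (I \<inter> J)"
    using sub subspace_inter by blast
  have "I \<subseteq> span (insert w (I \<inter> J))"
  proof
    fix x assume x: "x \<in> I"
    then have "x \<in> span (insert w J)" using K cov by (auto simp: covers_iff)
    then obtain c where "x - scale c w \<in> J"
      unfolding span_breakdown_eq span_of_subspace[OF sub(2)] by blast
    moreover have "x - scale c w \<in> I"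
      using x w sub subspace_diff subspace_scale by blast
    ultimately have "x - scale c w \<in> span (I \<inter> J)"
      by (auto intro: span_base)
    then show "x \<in> span (insert w (I \<inter> J))"
      using span_breakdown_eq by blast
  qed
  moreover have "span (insert w (I \<inter> J)) \<subseteq> I"
    using w sub by (intro span_minimal) auto
  ultimately have "I = span (insert w (I \<inter> J))" by blast
  then show ?thesis
    using covers_spanI[OF IJ, of w] w by auto
qed

text \<open>The dual of \<open>covers_Int\<close>: a vector of \<open>I\<close> outside
  \<open>J\<close> generates \<open>I\<close> over \<open>Z\<close>, hence the sum of
  \<open>I\<close> and \<open>J\<close> over \<open>J\<close>.\<close>

lemma covers_span_Un:
  assumes sub: "subspace I" "subspace J" "subspace Z"
    and cov: "covers scale I Z" "covers scale J Z" and "I \<noteq> J"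
  shows "covers scale (span (I \<union> J)) J"
proof -
  have "\<not> I \<subseteq> J"
    using assms subspace_eqI[of J I] by (auto simp: covers_iff)
  then obtain w where w: "w \<in> I" "w \<notin> J" by blast
  then have I: "I = span (insert w Z)"
    using sub cov by (intro covers_eq_span) (auto simp: covers_iff)
  have "I \<subseteq> span (insert w J)"
    unfolding I using cov by (intro span_mono) (auto simp: covers_iff)
  then have "span (I \<union> J) \<subseteq> span (insert w J)"
    by (intro span_minimal) (auto intro: span_base)
  moreover have "span (insert w J) \<subseteq> span (I \<union> J)"
    using w by (intro span_mono) auto
  ultimately show ?thesis
    using covers_spanI[of J w] w sub by auto
qed

text \<open>A common cover can only be the span of the union, and then the intersection is covered
  by both; dually, a subspace covered by both can only be the intersection. So the two sets are
  empty together or singletons together.\<close>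

lemma card_common_covers:
  assumes sub: "subspace I" "subspace J" and "I \<noteq> J"
  shows "card {K. subspace K \<and> covers scale K I \<and> covers scale K J} =
    card {K. subspace K \<and> covers scale I K \<and> covers scale J K}" (is "card ?U = card ?L")
proof -
  have U: "K = span (I \<union> J) \<and> I \<inter> J \<in> ?L" if K: "K \<in> ?U" for K
  proof
    have L: "covers scale I (I \<inter> J)" "covers scale J (I \<inter> J)"
      using assms K covers_Int[of I J K] covers_Int[of J I K] by (auto simp: Int_commute)
    show IJ: "I \<inter> J \<in> ?L" using L sub subspace_inter by blast
    have "covers scale (span (I \<union> J)) J"
      using covers_span_Un[of I J "I \<inter> J"] assms L IJ by auto
    moreover have "span (I \<union> J) \<subseteq> K"
      using K by (intro span_minimal) (auto simp: covers_iff)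
    ultimately show "K = span (I \<union> J)"
      using K by (intro subspace_eqI) (auto simp: covers_iff)
  qed
  have L: "K = I \<inter> J \<and> span (I \<union> J) \<in> ?U" if K: "K \<in> ?L" for K
  proof
    have cov: "covers scale (span (I \<union> J)) I" "covers scale (span (I \<union> J)) J"
      using assms K covers_span_Un[of I J K] covers_span_Un[of J I K] by (auto simp: Un_commute)
    then show "span (I \<union> J) \<in> ?U" by auto
    have IJ: "subspace (I \<inter> J)" using sub subspace_inter by blast
    have "covers scale I (I \<inter> J)"
      using assms cov covers_Int[of I J "span (I \<union> J)"] by auto
    then have "I \<inter> J = K"
      using K IJ by (intro subspace_eqI) (auto simp: covers_iff)
    then show "K = I \<inter> J" by simp
  qed
  show ?thesis
  proof (cases "?U = {} \<and> ?L = {}")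
    case True
    then show ?thesis by argo
  next
    case False
    then have "?U = {span (I \<union> J)}" "?L = {I \<inter> J}"
      using U L by blast+
    then show ?thesis by simp
  qed
qed

text \<open>The sets \<open>Y - Z\<close> partition \<open>W - Z\<close>, and each has
  \<open>q ^ dim Z * (q - 1)\<close> elements. The bound \<open>W\<close> allows counting inside an
  interval, which the count of hyperplanes needs.\<close>

lemma card_covers:
  assumes Z: "subspace Z" and W: "subspace W" and "Z \<subseteq> W"
  shows "real (card {Y. subspace Y \<and> Y \<subseteq> W \<and> covers scale Y Z}) * (real CARD('k) - 1) =
    real CARD('k) ^ (dim W - dim Z) - 1"
proof -
  let ?C = "{Y. subspace Y \<and> Y \<subseteq> W \<and> covers scale Y Z}" and ?q = "real CARD('k)"
  have union: "W - Z = (\<Union>Y\<in>?C. Y - Z)"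
  proof (intro subset_antisym subsetI)
    fix v assume v: "v \<in> W - Z"
    have "span (insert v Z) \<subseteq> W"
      using assms v by (intro span_minimal) auto
    then have "span (insert v Z) \<in> ?C"
      using covers_spanI[of Z v] Z v by simp
    moreover have "v \<in> span (insert v Z) - Z"
      using v span_base[of v] by simp
    ultimately show "v \<in> (\<Union>Y\<in>?C. Y - Z)" by (rule UN_I)
  qed auto
  have "card (\<Union>Y\<in>?C. Y - Z) = (\<Sum>Y\<in>?C. card (Y - Z))"
  proof (rule card_UN_disjoint[of ?C "\<lambda>Y. Y - Z"])
    have "X = Y" if "X \<in> ?C" "Y \<in> ?C" "v \<in> X - Z" "v \<in> Y - Z" for X Y v
      using that covers_eq_span[of X Z v] covers_eq_span[of Y Z v] Z by simp
    then show "\<forall>X\<in>?C. \<forall>Y\<in>?C. X \<noteq> Y \<longrightarrow> (X - Z) \<inter> (Y - Z) = {}"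
      by blast
  qed auto
  then have "card (W - Z) = (\<Sum>Y\<in>?C. card (Y - Z))"
    using union by simp
  moreover have "real (card (Y - Z)) = ?q ^ dim Z * (?q - 1)" if "Y \<in> ?C" for Y
    using that Z card_subspace[of Y] card_subspace[of Z] card_mono[of Y Z]
    by (simp add: covers_iff card_Diff_subset of_nat_diff algebra_simps)
  moreover have "real (card (W - Z)) = ?q ^ dim Z * (?q ^ (dim W - dim Z) - 1)"
    using assms card_subspace[of W] card_subspace[of Z] card_mono[of W Z] dim_subset[of Z W]
    by (simp add: card_Diff_subset of_nat_diff algebra_simps flip: power_add)
  ultimately have "?q ^ dim Z * (real (card ?C) * (?q - 1)) =
      ?q ^ dim Z * (?q ^ (dim W - dim Z) - 1)"
    by (simp add: mult.assoc mult.left_commute)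
  then show ?thesis by simp
qed

text \<open>
  Fix a hyperplane \<open>H\<close> of \<open>W\<close>. A hyperplane \<open>Y \<noteq> H\<close> is sorted by \<open>Y \<inter> H\<close>, a hyperplane of \<open>H\<close>
  that has \<open>q\<close> covers in \<open>W\<close> besides \<open>H\<close>, so the counts satisfy \<open>h (n + 1) = 1 + q h n\<close>.
\<close>
lemma card_covered:
  "subspace W \<Longrightarrow> real (card {Y. subspace Y \<and> covers scale W Y}) * (real CARD('k) - 1) =
    real CARD('k) ^ dim W - 1"
proof (induction "dim W" arbitrary: W)
  case 0
  have "{Y. subspace Y \<and> covers scale W Y} = {}"
    using 0(1) by (auto simp: covers_iff simp del: dim_eq_0)
  then show ?case unfolding 0(1)[symmetric] by (simp only: card.empty) simp
next
  case (Suc n)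
  let ?q = "real CARD('k)"
  let ?C = "\<lambda>Z. {Y. subspace Y \<and> Y \<subseteq> W \<and> covers scale Y Z}"
  obtain H where H: "subspace H" "H \<subseteq> span W" "dim H = n"
    using choose_subspace_of_subspace[of n W] Suc(2) by auto
  have WH: "covers scale W H"
    using H Suc(2) span_of_subspace[OF Suc(3)] by (auto simp: covers_iff)
  let ?L = "{Z. subspace Z \<and> covers scale H Z}"
  \<comment> \<open>\<open>Z\<close> has codimension 1 in both \<open>Y\<close> and
    \<open>H\<close>, so once \<open>Y \<inter> H\<close> differs from \<open>H\<close>, its
    dimension is squeezed down to that of \<open>Z\<close>. Thus \<open>Y\<close> determines
    \<open>Z\<close>, and the union below is disjoint.\<close>
  have Int: "Y \<inter> H = Z" if "Z \<in> ?L" "Y \<in> ?C Z" "Y \<noteq> H" for Y Z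
  proof (rule subspace_eqI)
    show "subspace (Y \<inter> H)" using that H subspace_inter by blast
    have "\<not> H \<subseteq> Y" using that H subspace_eqI[of Y H] by (auto simp: covers_iff)
    then have "Y \<inter> H \<noteq> H" by auto
    then have "dim (Y \<inter> H) \<noteq> dim H"
      using subspace_eqI[of H "Y \<inter> H"] H \<open>subspace (Y \<inter> H)\<close> by auto
    moreover have "dim (Y \<inter> H) \<le> dim H" "dim Z \<le> dim (Y \<inter> H)"
      using that dim_subset[of "Y \<inter> H" H] dim_subset[of Z "Y \<inter> H"] by (simp_all add: covers_iff)
    ultimately show "dim (Y \<inter> H) = dim Z" using that by (auto simp: covers_iff)
  qed (use that in \<open>auto simp: covers_iff\<close>)
  have eq: "{Y. subspace Y \<and> covers scale W Y} = insert H (\<Union>Z\<in>?L. ?C Z - {H})"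
  proof (intro subset_antisym subsetI)
    fix Y assume Y: "Y \<in> {Y. subspace Y \<and> covers scale W Y}"
    show "Y \<in> insert H (\<Union>Z\<in>?L. ?C Z - {H})"
    proof (cases "Y = H")
      case False
      have "covers scale Y (Y \<inter> H)"
        using Y H(1) Suc(3) WH False by (intro covers_Int[of Y H W]) auto
      moreover have "covers scale H (H \<inter> Y)"
        using Y H(1) Suc(3) WH False by (intro covers_Int[of H Y W]) auto
      moreover have "subspace (Y \<inter> H)" using Y H subspace_inter by blast
      moreover have "Y \<subseteq> W" using Y by (simp add: covers_iff)
      ultimately have "Y \<inter> H \<in> ?L" "Y \<in> ?C (Y \<inter> H) - {H}"
        using Y False by (simp_all add: Int_commute)
      then show ?thesis by blast
    qed simp
  qed (use H WH Suc(2) in \<open>auto simp: covers_iff\<close>)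
  \<comment> \<open>\<open>Z\<close> has codimension 2 in \<open>W\<close>, so \<open>q + 1\<close>
    spaces lie strictly between them, \<open>H\<close> being one.\<close>
  have "real (card (?C Z - {H})) = ?q" if Z: "Z \<in> ?L" for Z
  proof -
    have "real (card (?C Z)) * (?q - 1) = ?q ^ 2 - 1"
      using card_covers[of Z W] Z WH Suc(3) by (auto simp: covers_iff)
    also have "\<dots> = (?q + 1) * (?q - 1)" by (simp add: power2_eq_square algebra_simps)
    finally have "real (card (?C Z)) = ?q + 1"
      using card_field_gt_1[where 'k = 'k] by simp
    moreover have "H \<in> ?C Z" using Z H WH by (simp add: covers_iff)
    ultimately show ?thesis by (simp add: card_Diff_singleton)
  qed
  moreover have "card (\<Union>Z\<in>?L. ?C Z - {H}) = (\<Sum>Z\<in>?L. card (?C Z - {H}))"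
  proof (rule card_UN_disjoint[of ?L "\<lambda>Z. ?C Z - {H}"])
    have "X = X'" if "X \<in> ?L" "X' \<in> ?L" "Y \<in> ?C X - {H}" "Y \<in> ?C X' - {H}" for X X' Y
      using that Int[of X Y] Int[of X' Y] by simp
    then show "\<forall>X\<in>?L. \<forall>Y\<in>?L. X \<noteq> Y \<longrightarrow> (?C X - {H}) \<inter> (?C Y - {H}) = {}"
      by blast
  qed auto
  ultimately have "real (card (\<Union>Z\<in>?L. ?C Z - {H})) = ?q * card ?L"
    by simp
  moreover have "H \<notin> (\<Union>Z\<in>?L. ?C Z - {H})" by blast
  ultimately have "real (card {Y. subspace Y \<and> covers scale W Y}) = 1 + ?q * card ?L"
    unfolding eq by (subst card_insert_disjoint[OF finite_subspace_sets]) simp_all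
  then have "real (card {Y. subspace Y \<and> covers scale W Y}) * (?q - 1) =
      ?q - 1 + ?q * (card ?L * (?q - 1))"
    by (simp add: algebra_simps)
  also have "\<dots> = ?q ^ dim W - 1"
    using H Suc(2)[symmetric] unfolding Suc(1)[OF H(3)[symmetric] H(1)]
    by (simp add: algebra_simps)
  finally show ?case .
qed

end

subsection \<open>Matrices\<close>

lemma matrix_add_rdistrib: "(A + B) ** C = A ** C + B ** (C :: 'a::semiring_1^'n^'m)"
  by (simp add: vec_eq_iff matrix_matrix_mult_def sum.distrib algebra_simps)

lemma matrix_mult_scaleR:
  fixes A :: "'a::real_algebra_1 ^ 'n ^ 'm" and B :: "'a ^ 'k ^ 'n"
  shows "(r *\<^sub>R A) ** B = r *\<^sub>R (A ** B)" "A ** (r *\<^sub>R B) = r *\<^sub>R (A ** B)"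
  by (simp_all add: matrix_scalar_ac scalar_matrix_assoc)

lemma matrix_diff_ldistrib:
  fixes A :: "'a::ring_1 ^ 'n ^ 'm"
  shows "A ** (B - C) = A ** B - A ** C"
  by (simp add: vec_eq_iff matrix_matrix_mult_def sum_subtractf algebra_simps)

lemma matrix_diff_rdistrib:
  fixes C :: "'a::ring_1 ^ 'n ^ 'm"
  shows "(A - B) ** C = A ** C - B ** C"
  by (simp add: vec_eq_iff matrix_matrix_mult_def sum_subtractf algebra_simps)

text \<open>The left-hand side of the relation with its three factors \<open>A\<close> made
  independent, so that it can be expanded over \<open>P\<close>, \<open>Q\<close>,
  \<open>R\<close>.\<close>

definition tri :: "real \<Rightarrow> complex^'x^'x \<Rightarrow> complex^'x^'x \<Rightarrow> complex^'x^'x \<Rightarrow> complex^'x^'x \<Rightarrow>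
    complex^'x^'x::finite"
  where
  "tri b X U V W = U ** V ** W ** X - b *\<^sub>R (U ** V ** X ** W)
    + b *\<^sub>R (U ** X ** V ** W) - X ** U ** V ** W"

lemma tri_add:
  "tri b X (U + U') V W = tri b X U V W + tri b X U' V W"
  "tri b X U (V + V') W = tri b X U V W + tri b X U V' W"
  "tri b X U V (W + W') = tri b X U V W + tri b X U V W'"
  unfolding tri_def
  by (simp_all add: matrix_add_ldistrib matrix_add_rdistrib scaleR_add_right)

text \<open>On its way to the far left, \<open>X\<close> passes all three factors in the first term,
  two in the second, one in the third and none in the last.\<close>

lemma tri_homogeneous:
  fixes X U V W :: "complex^'x^'x"
  assumes "U ** X = u *\<^sub>R (X ** U)" "V ** X = v *\<^sub>R (X ** V)" "W ** X = w *\<^sub>R (X ** W)"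
  shows "tri b X U V W = (u * v * w - b * (u * v) + b * u - 1) *\<^sub>R (X ** (U ** V ** W))"
proof -
  have "Y ** U ** X = u *\<^sub>R (Y ** X ** U)" "Y ** V ** X = v *\<^sub>R (Y ** X ** V)"
    "Y ** W ** X = w *\<^sub>R (Y ** X ** W)"
    for Y :: "complex^'x^'x"
    by (metis assms matrix_mul_assoc matrix_mult_scaleR(2))+
  then show ?thesis
    by (simp add: tri_def assms matrix_mult_scaleR matrix_mul_assoc algebra_simps)
qed

text \<open>For three factors of equal weight \<open>t\<close> the scalar is
  \<open>(t - 1) * (t - q) * (t - 1 / q)\<close>, which explains the choice of
  \<open>\<beta>\<close>: it kills the cubes of \<open>P\<close>, \<open>Q\<close> and
  \<open>R\<close>. Mixed words cancel after reordering, up to the terms with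
  \<open>\<sigma>\<close> left by moving \<open>G\<close> past \<open>P\<close> and
  \<open>R\<close>.\<close>

lemma tridiagonal_relation:
  fixes P Q R X :: "complex^'x^'x::finite" and q \<sigma> \<beta> :: real
  assumes q: "q > 0" and \<beta>: "\<beta> = q + 1 / q"
    and X: "P ** X = q *\<^sub>R (X ** P)" "Q ** X = X ** Q" "R ** X = (1 / q) *\<^sub>R (X ** R)"
    and Q: "P ** Q = (1 / q) *\<^sub>R (Q ** P)" "R ** Q = q *\<^sub>R (Q ** R)"
    and G: "R ** P = q *\<^sub>R (P ** R) + G"
    and PG: "q\<^sup>2 *\<^sub>R (P ** G) - G ** P = \<sigma> *\<^sub>R P"
    and RG: "q\<^sup>2 *\<^sub>R (G ** R) - R ** G = \<sigma> *\<^sub>R R"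
  defines "A \<equiv> P + Q + R"
  shows "tri (\<beta> + 1) X A A A = (\<sigma> * (q + 1) / q\<^sup>2) *\<^sub>R (A ** X - X ** A)"
proof -
  \<comment> \<open>Words are associated to the left, so the rules are also needed behind a prefix
    \<open>Y\<close>.\<close>
  have Q': "Y ** P ** Q = (1 / q) *\<^sub>R (Y ** Q ** P)"
    "Y ** R ** Q = q *\<^sub>R (Y ** Q ** R)" for Y :: "complex^'x^'x"
    by (metis Q matrix_mul_assoc matrix_mult_scaleR(2))+
  have GQ: "G ** Q = Q ** G"
  proof -
    \<comment> \<open>\<open>Q\<close> passes one \<open>P\<close> and one \<open>R\<close>, and the
      factors \<open>1 / q\<close> and \<open>q\<close> cancel.\<close>
    have "R ** P ** Q = Q ** (R ** P)" "P ** R ** Q = Q ** (P ** R)"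
      using q by (simp_all add: Q' Q matrix_mult_scaleR matrix_mul_assoc)
    moreover have "G = R ** P - q *\<^sub>R (P ** R)" using G by simp
    ultimately show ?thesis
      by (simp add: matrix_diff_ldistrib matrix_diff_rdistrib matrix_mult_scaleR)
  qed
  then have GQ': "Y ** G ** Q = Y ** Q ** G" for Y :: "complex^'x^'x"
    by (metis matrix_mul_assoc)
  have GP: "G ** P = q\<^sup>2 *\<^sub>R (P ** G) - \<sigma> *\<^sub>R P" using PG by (simp add: algebra_simps)
  have RG': "R ** G = q\<^sup>2 *\<^sub>R (G ** R) - \<sigma> *\<^sub>R R" using RG by (simp add: algebra_simps)
  have G': "Y ** R ** P = q *\<^sub>R (Y ** P ** R) + Y ** G" for Y :: "complex^'x^'x"
    by (metis G matrix_mul_assoc matrix_mult_scaleR(2) matrix_add_ldistrib)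
  have hom: "P ** X = q *\<^sub>R (X ** P)" "Q ** X = 1 *\<^sub>R (X ** Q)" "R ** X = (1 / q) *\<^sub>R (X ** R)"
    using X by auto
  note homogeneous = hom[THEN tri_homogeneous, OF hom(1) hom(1)]
    hom[THEN tri_homogeneous, OF hom(1) hom(2)] hom[THEN tri_homogeneous, OF hom(1) hom(3)]
    hom[THEN tri_homogeneous, OF hom(2) hom(1)] hom[THEN tri_homogeneous, OF hom(2) hom(2)]
    hom[THEN tri_homogeneous, OF hom(2) hom(3)] hom[THEN tri_homogeneous, OF hom(3) hom(1)]
    hom[THEN tri_homogeneous, OF hom(3) hom(2)] hom[THEN tri_homogeneous, OF hom(3) hom(3)]
  note bilinear = matrix_mult_scaleR matrix_add_ldistrib matrix_add_rdistrib
    matrix_diff_ldistrib matrix_diff_rdistrib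
  have "tri (\<beta> + 1) X A A A =
    ((q - 1) * \<sigma> * (q + 1) / q\<^sup>2) *\<^sub>R (X ** P) - ((q - 1) * \<sigma> * (q + 1) / q ^ 3) *\<^sub>R (X ** R)"
    unfolding A_def tri_add homogeneous using q
    \<comment> \<open>normal form: \<open>Q\<close> is moved to the left of \<open>P\<close> and \<open>R\<close>, then \<open>P\<close> to the left of \<open>R\<close>\<close>
    apply (simp add: Q Q' G G' GP RG' bilinear)
    apply (simp add: matrix_mul_assoc Q Q' G G' GP RG' GQ' bilinear)
    apply (simp add: vec_eq_iff)
    apply (simp add: \<beta> scaleR_conv_of_real)
    apply (simp add: field_simps power2_eq_square power3_eq_cube)
    done
  \<comment> \<open>In the commutator \<open>Q\<close> drops out, \<open>P\<close> contributes
    \<open>(q - 1) *\<^sub>R (X ** P)\<close>, and \<open>R\<close> contributes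
    \<open>X ** R\<close> with factor \<open>-(q - 1) / q\<close>.\<close>
  also have "\<dots> = (\<sigma> * (q + 1) / q\<^sup>2) *\<^sub>R (A ** X - X ** A)"
    using q unfolding A_def
    by (simp add: X matrix_add_ldistrib matrix_add_rdistrib vec_eq_iff)
      (simp add: scaleR_conv_of_real field_simps power2_eq_square power3_eq_cube)
  finally show ?thesis .
qed

section \<open>The commutation rules in the subspace lattice\<close>

lemma diagonal_mult:
  fixes M :: "'a::semiring_1 ^ 'm ^ 'n" and M' :: "'a ^ 'n ^ 'm"
  shows "(\<chi> i j. if i = j then d i else 0) ** M = (\<chi> i j. d i * M $ i $ j)"
    and "M' ** (\<chi> i j. if i = j then d i else 0) = (\<chi> i j. M' $ i $ j * d j)"
  by (simp_all add: vec_eq_iff matrix_matrix_mult_def if_distrib[where f = "\<lambda>x. x * _"]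
      if_distrib[where f = "\<lambda>x. _ * x"] cong: if_cong)

context finite_vector_space
begin

lemma card_labels:
  fixes S :: "'x::finite \<Rightarrow> 'v set"
  assumes "bij_betw S UNIV (subspaces scale)"
  shows "card {k. C (S k)} = card {K. subspace K \<and> C K}"
proof -
  have range: "range S = {K. subspace K}" and inj: "inj S"
    using assms by (simp_all add: bij_betw_def subspaces_def)
  have "S ` {k. C (S k)} = {K \<in> range S. C K}"
    by blast
  also have "\<dots> = {K. subspace K \<and> C K}"
    unfolding range by simp
  finally show ?thesis
    using card_image[OF inj_on_subset[OF inj subset_UNIV], of "{k. C (S k)}"] by simp
qed

text \<open>Multiplied by \<open>\<phi> * q ^ dim (S i)\<close>, this difference is the
  \<open>(i, j)\<close> entry of \<open>R ** P - q *\<^sub>R (P ** R)\<close>.\<close>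

lemma lowering_raising_commutation:
  fixes S :: "'x::finite \<Rightarrow> 'v set"
  defines "q \<equiv> real CARD('k)"
  assumes S: "bij_betw S UNIV (subspaces scale)"
  shows "real (card {k. covers scale (S k) (S i) \<and> covers scale (S k) (S j)})
      - real (card {k. covers scale (S i) (S k) \<and> covers scale (S j) (S k)}) =
    (if i = j then (q ^ (dimension - dim (S i)) - q ^ dim (S i)) / (q - 1) else 0)"
proof -
  have sub: "subspace (S k)" for k
    using S by (auto simp: bij_betw_def subspaces_def)
  show ?thesis
  proof (cases "i = j")
    case False
    then have "S i \<noteq> S j" using S by (auto simp: bij_betw_def inj_def)
    then show ?thesis
      using False card_common_covers[OF sub sub]
        card_labels[OF S, of "\<lambda>K. covers scale K (S i) \<and> covers scale K (S j)"]
        card_labels[OF S, of "\<lambda>K. covers scale (S i) K \<and> covers scale (S j) K"]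
      by simp
  next
    case True
    have "q - 1 \<noteq> 0" using card_field_gt_1[where 'k = 'k] by (simp add: q_def)
    moreover have "real (card {k. covers scale (S k) (S i)}) * (q - 1) = q ^ (dimension - dim (S i)) - 1"
      using card_covers[OF sub subspace_UNIV, of i] card_labels[OF S, of "\<lambda>K. covers scale K (S i)"]
      by (simp add: q_def dimension_def)
    moreover have "real (card {k. covers scale (S i) (S k)}) * (q - 1) = q ^ dim (S i) - 1"
      using card_covered[OF sub, of i] card_labels[OF S, of "\<lambda>K. covers scale (S i) K"]
      by (simp add: q_def)
    ultimately show ?thesis
      using True by (simp add: eq_divide_eq algebra_simps)
  qed
qed

lemma A_mat_tridiagonal_relation:
  fixes S :: "'x::finite \<Rightarrow> 'v set" and \<phi> :: real
  defines "q \<equiv> real CARD('k)" and "A \<equiv> A_mat scale \<phi> S" and "A' \<equiv> A_star scale S"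
  assumes S: "bij_betw S UNIV (subspaces scale)"
  shows "tri (q + 1 / q + 1) A' A A A =
    (\<phi> * q ^ dimension * (q + 1)\<^sup>2 / q\<^sup>2) *\<^sub>R (A ** A' - A' ** A)"
proof -
  let ?d = "\<lambda>i. dim (S i)"
  define P :: "complex^'x^'x" where "P = (\<chi> i j. if covers scale (S i) (S j) then 1 else 0)"
  define Q :: "complex^'x^'x" where
    "Q = (\<chi> i j. if i = j then of_real ((\<phi> - 1) / (q - 1) * q ^ ?d i) else 0)"
  define R :: "complex^'x^'x" where
    "R = (\<chi> i j. if covers scale (S j) (S i) then of_real (\<phi> * q ^ ?d i) else 0)"
  define g where "g = (\<lambda>d. \<phi> * (q ^ dimension - q ^ (2 * d)) / (q - 1))"
  define G :: "complex^'x^'x" where "G = (\<chi> i j. if i = j then of_real (g (?d i)) else 0)"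
  have q: "q > 1" using card_field_gt_1[where 'k = 'k] by (simp add: q_def)
  \<comment> \<open>The powers \<open>q ^ (2 * d + 2)\<close> cancel, and
    \<open>(q\<^sup>2 - 1) / (q - 1)\<close> leaves \<open>q + 1\<close>. Since \<open>P\<close> and
    \<open>R\<close> link only neighbouring dimensions, this one identity yields both rules for
    \<open>G\<close>, with the right-hand side as \<open>\<sigma>\<close>.\<close>
  have g_step: "q\<^sup>2 * g d - g (Suc d) = \<phi> * q ^ dimension * (q + 1)" for d
  proof -
    have "q\<^sup>2 * g d - g (Suc d) = \<phi> * q ^ dimension * (q + 1) * (q - 1) / (q - 1)"
      by (simp add: g_def power2_eq_square algebra_simps flip: diff_divide_distrib)
    then show ?thesis using q by simp
  qed
  have A': "A' = (\<chi> i j. if i = j then of_real (1 / q ^ ?d i) else 0)"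
    by (simp add: A'_def A_star_def q_def vec_eq_iff)
  \<comment> \<open>The cases of \<open>A_mat\<close> exclude each other, because the dimensions
    differ by 1, -1 and 0 respectively.\<close>
  have A: "A = P + Q + R"
    by (auto simp: A_def A_mat_def P_def Q_def R_def q_def vec_eq_iff covers_iff)
  have "tri (q + 1 / q + 1) A' (P + Q + R) (P + Q + R) (P + Q + R) =
    (\<phi> * q ^ dimension * (q + 1) * (q + 1) / q\<^sup>2) *\<^sub>R ((P + Q + R) ** A' - A' ** (P + Q + R))"
  proof (rule tridiagonal_relation[where G = G])
    show "P ** A' = q *\<^sub>R (A' ** P)" "Q ** A' = A' ** Q" "R ** A' = (1 / q) *\<^sub>R (A' ** R)"
      using q by (auto simp: A' diagonal_mult vec_eq_iff P_def Q_def R_def covers_iff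
        scaleR_conv_of_real[where 'a = complex])
    show "P ** Q = (1 / q) *\<^sub>R (Q ** P)" "R ** Q = q *\<^sub>R (Q ** R)"
      using q by (auto simp: diagonal_mult vec_eq_iff P_def Q_def R_def covers_iff
        scaleR_conv_of_real[where 'a = complex])
    have "(q\<^sup>2 *\<^sub>R (P ** G) - G ** P) $ i $ j =
        of_real (q\<^sup>2 * g (?d j) - g (?d i)) * P $ i $ j" for i j
      by (simp add: G_def diagonal_mult scaleR_conv_of_real[where 'a = complex] algebra_simps)
    moreover have "P $ i $ j = 0 \<or> ?d i = Suc (?d j)" for i j
      by (simp add: P_def covers_iff)
    ultimately have "(q\<^sup>2 *\<^sub>R (P ** G) - G ** P) $ i $ j =
        of_real (\<phi> * q ^ dimension * (q + 1)) * P $ i $ j" for i j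
      by (metis g_step mult_zero_right)
    then show "q\<^sup>2 *\<^sub>R (P ** G) - G ** P = (\<phi> * q ^ dimension * (q + 1)) *\<^sub>R P"
      by (simp only: vec_eq_iff vector_scaleR_component scaleR_conv_of_real[where 'a = complex]) simp
    have "(q\<^sup>2 *\<^sub>R (G ** R) - R ** G) $ i $ j =
        of_real (q\<^sup>2 * g (?d i) - g (?d j)) * R $ i $ j" for i j
      by (simp add: G_def diagonal_mult scaleR_conv_of_real[where 'a = complex] algebra_simps)
    moreover have "R $ i $ j = 0 \<or> ?d j = Suc (?d i)" for i j
      by (simp add: R_def covers_iff)
    ultimately have "(q\<^sup>2 *\<^sub>R (G ** R) - R ** G) $ i $ j =
        of_real (\<phi> * q ^ dimension * (q + 1)) * R $ i $ j" for i j
      by (metis g_step mult_zero_right)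
    then show "q\<^sup>2 *\<^sub>R (G ** R) - R ** G = (\<phi> * q ^ dimension * (q + 1)) *\<^sub>R R"
      by (simp only: vec_eq_iff vector_scaleR_component scaleR_conv_of_real[where 'a = complex]) simp
    show "R ** P = q *\<^sub>R (P ** R) + G"
    proof -
      have sum_indicator: "(\<Sum>k\<in>UNIV. if k \<in> K then of_real c else 0 :: complex) =
          of_real (c * real (card K))"
        for c and K :: "'x set"
        by (simp add: sum.If_cases mult.commute)
      have "(R ** P - q *\<^sub>R (P ** R)) $ i $ j = G $ i $ j" for i j
      proof -
        let ?up = "{k. covers scale (S k) (S i) \<and> covers scale (S k) (S j)}"
        let ?down = "{k. covers scale (S i) (S k) \<and> covers scale (S j) (S k)}"
        have "(R ** P) $ i $ j =
            (\<Sum>k\<in>UNIV. if k \<in> ?up then of_real (\<phi> * q ^ ?d i) else 0)"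
          unfolding matrix_matrix_mult_def R_def P_def by (auto intro!: sum.cong)
        also have "\<dots> = of_real (\<phi> * q ^ ?d i * real (card ?up))"
          by (rule sum_indicator)
        finally have up: "(R ** P) $ i $ j = of_real (\<phi> * q ^ ?d i * real (card ?up))" .
        \<comment> \<open>Here \<open>S i\<close> covers \<open>S k\<close>, so the extra
          \<open>q\<close> turns \<open>q ^ dim (S k)\<close> into \<open>q ^ dim (S i)\<close>, the
          factor already found in \<open>R ** P\<close>.\<close>
        have "q *\<^sub>R (P ** R) $ i $ j =
            (\<Sum>k\<in>UNIV. if k \<in> ?down then of_real (\<phi> * q ^ ?d i) else 0)"
          unfolding matrix_matrix_mult_def R_def P_def
          by (auto simp: scaleR_conv_of_real[where 'a = complex] sum_distrib_left covers_iff
              intro!: sum.cong)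
        also have "\<dots> = of_real (\<phi> * q ^ ?d i * real (card ?down))"
          by (rule sum_indicator)
        finally have "(R ** P - q *\<^sub>R (P ** R)) $ i $ j =
            of_real (\<phi> * q ^ ?d i * (real (card ?up) - real (card ?down)))"
          using up by (simp add: right_diff_distrib)
        also have "\<phi> * q ^ ?d i * (real (card ?up) - real (card ?down)) =
            (if i = j then g (?d i) else 0)"
        proof -
          have "q ^ ?d i * q ^ (dimension - ?d i) = q ^ dimension"
            using dim_subset_UNIV[of "S i"] by (simp flip: power_add)
          then show ?thesis
            unfolding lowering_raising_commutation[OF S, folded q_def]
            by (auto simp: g_def right_diff_distrib mult_2 power_add mult.assoc)
        qed
        also have "of_real \<dots> = G $ i $ j"
          by (simp add: G_def)
        finally show ?thesis .
      qed
      then have "R ** P - q *\<^sub>R (P ** R) = G" by (simp add: vec_eq_iff)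
      then show ?thesis by (simp add: algebra_simps)
    qed
  qed (use q in auto)
  then show ?thesis by (simp add: A power2_eq_square mult.assoc)
qed

end

section \<open>From the stated dimension to a finite basis\<close>

theorem proposition8p7:
  fixes scal :: "'k::{field,finite} \<Rightarrow> 'v::ab_group_add \<Rightarrow> 'v"
    and S :: "'x::finite \<Rightarrow> 'v set"
    and q N :: nat
    and \<phi> \<beta> \<rho> :: real
    and A A' :: "complex ^ 'x ^ 'x"
  assumes "q = CARD('k)"
    and "N \<ge> 1"
    and "vector_space scal"
    and "vector_space.dim scal (UNIV :: 'v set) = N"
    and "bij_betw S UNIV (subspaces scal)"
    and "\<phi> > 0"
    and "A = A_mat scal \<phi> S"
    and "A' = A_star scal S"
    and "\<beta> = real q + 1 / real q"
    and "\<rho> = \<phi> * real q powi (int N - 2) * (real q + 1)\<^sup>2"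
  shows "A ** A ** A ** A' - (\<beta> + 1) *\<^sub>R (A ** A ** A' ** A)
           + (\<beta> + 1) *\<^sub>R (A ** A' ** A ** A) - A' ** A ** A ** A
         = \<rho> *\<^sub>R (A ** A' - A' ** A)"
proof -
  interpret vector_space scal by fact
  obtain B where B: "independent B" "span B = UNIV" "card B = N"
    using basis_exists[of UNIV] assms(4) by (metis top.extremum_uniqueI)
  \<comment> \<open>An infinite basis would have \<open>card\<close> 0, contrary to
    \<open>N \<ge> 1\<close>.\<close>
  moreover have "finite B"
    using B(3) assms(2) by (intro card_ge_0_finite) simp
  ultimately interpret finite_vector_space scal B
    by unfold_locales
  have "dimension = N" using B by (simp add: dimension_def)
  \<comment> \<open>The exponent is negative for \<open>N = 1\<close>, hence the integer power and
    the division by \<open>q\<^sup>2\<close>.\<close>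
  moreover have "real q powi (int N - 2) = real q ^ N / (real q)\<^sup>2"
    using assms(1) by (simp add: power_int_diff)
  ultimately show ?thesis
    using A_mat_tridiagonal_relation[OF assms(5), of \<phi>, folded assms(1,7,8)]
    unfolding tri_def assms(9,10) by simp
qed

end
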